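(* Let $k\in[2,3)$ be rational and $\varepsilon$ a positive real with $\varepsilon<\frac{1+\varepsilon}{k+\varepsilon}$. Then there exist a graph $G$ with fractional chromatic number $k$, a set $W\subseteq V(G)$ of vertices at pairwise distance at least four, and a fractional $(k+\varepsilon)$-precoloring of $W$ that cannot be extended to a fractional $(k+\varepsilon)$-coloring of $G$.
   Context: A fractional $m$-coloring of a graph (real $m>0$) assigns to each vertex a measurable subset of $[0,m)$ of Lebesgue measure one so that adjacent vertices receive disjoint sets; the fractional chromatic number is the infimum (for finite graphs the minimum) of $m$ for which a fractional $m$-coloring exists. A fractional $m$-precoloring of a vertex set $W$ assigns measurable subsets of $[0,m)$ of measure one to the vertices of $W$; it extends if some fractional $m$-coloring of the whole graph agrees with it on $W$. Graphs are finite. *)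

theory Defs
  imports "HOL-Analysis.Analysis"
begin

definition finite_graph :: "'a set \<Rightarrow> ('a \<Rightarrow> 'a \<Rightarrow> bool) \<Rightarrow> bool" where
  "finite_graph V E \<longleftrightarrow> finite V \<and> (\<forall>u v. E u v \<longrightarrow> u \<in> V \<and> v \<in> V)
     \<and> (\<forall>u v. E u v \<longrightarrow> E v u) \<and> (\<forall>v. \<not> E v v)"

definition frac_color_set :: "real \<Rightarrow> real set \<Rightarrow> bool" where
  "frac_color_set m S \<longleftrightarrow> S \<in> sets lebesgue \<and> S \<subseteq> {0..<m} \<and> emeasure lebesgue S = 1"

definition frac_coloring :: "'a set \<Rightarrow> ('a \<Rightarrow> 'a \<Rightarrow> bool) \<Rightarrow> real \<Rightarrow> ('a \<Rightarrow> real set) \<Rightarrow> bool" where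
  "frac_coloring V E m c \<longleftrightarrow> (\<forall>v\<in>V. frac_color_set m (c v))
     \<and> (\<forall>u\<in>V. \<forall>v\<in>V. E u v \<longrightarrow> c u \<inter> c v = {})"

definition frac_chromatic_number :: "'a set \<Rightarrow> ('a \<Rightarrow> 'a \<Rightarrow> bool) \<Rightarrow> real" where
  "frac_chromatic_number V E = Inf {m. m > 0 \<and> (\<exists>c. frac_coloring V E m c)}"

definition frac_precoloring :: "'a set \<Rightarrow> real \<Rightarrow> ('a \<Rightarrow> real set) \<Rightarrow> bool" where
  "frac_precoloring W m p \<longleftrightarrow> (\<forall>w\<in>W. frac_color_set m (p w))"

definition frac_extends :: "'a set \<Rightarrow> ('a \<Rightarrow> 'a \<Rightarrow> bool) \<Rightarrow> 'a set \<Rightarrow> real \<Rightarrow> ('a \<Rightarrow> real set) \<Rightarrow> bool" where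
  "frac_extends V E W m p \<longleftrightarrow> (\<exists>c. frac_coloring V E m c \<and> (\<forall>w\<in>W. c w = p w))"

fun is_walk :: "('a \<Rightarrow> 'a \<Rightarrow> bool) \<Rightarrow> 'a list \<Rightarrow> bool" where
  "is_walk E [] = False"
| "is_walk E [x] = True"
| "is_walk E (x # y # xs) = (E x y \<and> is_walk E (y # xs))"

definition dist_at_least :: "('a \<Rightarrow> 'a \<Rightarrow> bool) \<Rightarrow> 'a \<Rightarrow> 'a \<Rightarrow> nat \<Rightarrow> bool" where
  "dist_at_least E u v n \<longleftrightarrow>
     (\<forall>xs. is_walk E xs \<and> hd xs = u \<and> last xs = v \<longrightarrow> length xs - 1 \<ge> n)"

end

theory Submission
  imports Defs
begin

text \<open>
  Write \<open>k = p / q\<close>. The core of the graph is the circular clique \<open>K\<^bsub>p/q\<^esub>\<close> on \<open>{0..<p}\<close>. Every core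
  vertex \<open>i\<close> gets many twins with the same core neighbours, and each twin carries one pendant,
  precolored leaf. In a circular clique every independent set \<open>S\<close> satisfies
  \<open>|N(S)| \<ge> (k - 1) |S|\<close>. Integrating this over the color classes shows that in any fractional
  coloring some core vertex \<open>i\<close> sees a set \<open>U\<close> of colors of measure at least \<open>k - 1\<close> on its
  neighbours. A twin of \<open>i\<close> whose leaf has color set \<open>P\<close> must avoid \<open>U \<union> P\<close>, which forces
  \<open>|U \<inter> P| \<ge> |U| + 2 - (k + \<epsilon>)\<close>. The sets \<open>P\<close> at the twins of \<open>i\<close> are the rotations of a unit arc
  in a circle of rational length \<open>m' < k + \<epsilon>\<close>, so the average of \<open>|U \<inter> P|\<close> is at most \<open>|U| / m'\<close>;
  for \<open>m'\<close> close to \<open>k + \<epsilon>\<close> this contradicts the bound on \<open>\<epsilon>\<close>.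
\<close>

text \<open>In \<open>Twin i t\<close> and \<open>Leaf i t\<close>, \<open>i\<close> names the core
  vertex being copied and \<open>t\<close> the rotation of the arc that will precolor the
  leaf.\<close>

datatype vertex = Core int | Twin int int | Leaf int int

instance vertex :: countable
  by countable_datatype

section \<open>Independent sets in circular cliques\<close>

definition circ_adj :: "int \<Rightarrow> int \<Rightarrow> int \<Rightarrow> int \<Rightarrow> bool" where
  "circ_adj p q i j \<longleftrightarrow> q \<le> (i - j) mod p \<and> (i - j) mod p \<le> p - q"

definition circ_indep :: "int \<Rightarrow> int \<Rightarrow> int set \<Rightarrow> bool" where
  "circ_indep p q S \<longleftrightarrow> S \<subseteq> {0..<p} \<and> (\<forall>i\<in>S. \<forall>j\<in>S. \<not> circ_adj p q i j)"

definition window :: "int \<Rightarrow> int \<Rightarrow> int \<Rightarrow> int set" where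
  "window p q i = {l\<in>{0..<p}. (l - i) mod p < q}"

text \<open>A unit arc starting at \<open>i / q\<close> on the circle of length
  \<open>p / q\<close>, cut into cells of length \<open>1 / q\<close> so that measure questions
  become counting. It serves twice: with \<open>p\<close>, \<open>q\<close> for coloring the gadget
  and with \<open>n\<close>, \<open>r\<close> for the precoloring.\<close>

definition arc :: "int \<Rightarrow> int \<Rightarrow> int \<Rightarrow> real set" where
  "arc p q i = (\<Union>l\<in>window p q i. {l / q..<(l + 1) / q})"

lemma finite_window: "finite (window p q i)"
  by (rule finite_subset[of _ "{0..<p}"]) (auto simp: window_def)

lemma circ_adj_sym:
  assumes "0 < q" "q \<le> p" "circ_adj p q i j"
  shows "circ_adj p q j i"
proof -
  have "(j - i) mod p = (if (i - j) mod p = 0 then 0 else p - (i - j) mod p)"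
    using zmod_zminus1_eq_if[of "i - j" p] by simp
  then show ?thesis using assms by (auto simp: circ_adj_def)
qed

lemma circ_adj_irrefl: "0 < q \<Longrightarrow> \<not> circ_adj p q i i"
  by (simp add: circ_adj_def)

lemma inj_on_mod_diff:
  fixes p :: int
  shows "inj_on (\<lambda>l. (l - i) mod p) {0..<p}" "inj_on (\<lambda>i. (l - i) mod p) {0..<p}"
proof -
  have *: "a = b" if "p dvd a - b" "a \<in> {0..<p}" "b \<in> {0..<p}" for a b
  proof -
    have "a mod p = b mod p" using that(1) by (simp add: mod_eq_dvd_iff)
    then show ?thesis using that by simp
  qed
  show "inj_on (\<lambda>l. (l - i) mod p) {0..<p}"
    by (rule inj_onI, rule *) (simp_all add: mod_eq_dvd_iff)
  show "inj_on (\<lambda>i. (l - i) mod p) {0..<p}"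
  proof (rule inj_onI)
    fix x y assume "x \<in> {0..<p}" "y \<in> {0..<p}" "(l - x) mod p = (l - y) mod p"
    then show "x = y" using *[of y x] by (simp add: mod_eq_dvd_iff)
  qed
qed

text \<open>An injective self-map of \<open>{0..<p}\<close> is a permutation. Applied to
  \<open>(l - i) mod p\<close> as a function of \<open>l\<close> and of \<open>i\<close>, this gives
  both window counts.\<close>

lemma card_preimage_perm:
  fixes p q :: int
  assumes "0 \<le> q" "q \<le> p" "inj_on f {0..<p}" "f ` {0..<p} \<subseteq> {0..<p}"
  shows "card {x\<in>{0..<p}. f x < q} = nat q"
proof -
  have "f ` {0..<p} = {0..<p}" using assms(3,4) by (simp add: endo_inj_surj)
  moreover have "f ` {x\<in>{0..<p}. f x < q} = f ` {0..<p} \<inter> {..<q}" by auto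
  ultimately have "f ` {x\<in>{0..<p}. f x < q} = {0..<q}" using assms(2) by auto
  moreover have "inj_on f {x\<in>{0..<p}. f x < q}"
    using assms(3) by (rule inj_on_subset) auto
  ultimately show ?thesis by (metis card_image card_atLeastLessThan_int diff_zero)
qed

lemma card_window:
  assumes "0 < q" "q \<le> p"
  shows "card (window p q i) = nat q"
  unfolding window_def
  by (rule card_preimage_perm) (use assms inj_on_mod_diff in auto)

lemma card_windows_containing:
  assumes "0 < q" "q \<le> p" "l \<in> {0..<p}"
  shows "card {i\<in>{0..<p}. l \<in> window p q i} = nat q"
proof -
  have "{i\<in>{0..<p}. l \<in> window p q i} = {i\<in>{0..<p}. (l - i) mod p < q}"
    using assms by (auto simp: window_def)
  then show ?thesis
    using card_preimage_perm[of q p "\<lambda>i. (l - i) mod p"] assms inj_on_mod_diff(2)[of l p]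
    by (simp add: image_subset_iff)
qed

text \<open>A common element has offsets \<open>a\<close>, \<open>b\<close> in
  \<open>{0..<q}\<close> from \<open>i\<close> and \<open>j\<close>, so \<open>i - j\<close> is
  congruent to \<open>b - a\<close>, whose absolute value is below \<open>q\<close>.\<close>

lemma windows_disjoint:
  assumes "0 < q" "circ_adj p q i j"
  shows "window p q i \<inter> window p q j = {}"
proof (rule ccontr)
  assume "window p q i \<inter> window p q j \<noteq> {}"
  then obtain l where l: "0 \<le> l" "l < p" "(l - i) mod p < q" "(l - j) mod p < q"
    by (auto simp: window_def)
  define a b where "a = (l - i) mod p" and "b = (l - j) mod p"
  have ab: "0 \<le> a" "a < q" "0 \<le> b" "b < q" "q \<le> p"
    using l assms by (auto simp: a_def b_def circ_adj_def)
  have "(i - j) mod p = (b - a) mod p"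
    by (simp add: a_def b_def mod_diff_eq)
  moreover have "(b - a) mod p = (if a \<le> b then b - a else b - a + p)"
  proof (cases "a \<le> b")
    case False
    have "(b - a) mod p = (b - a + p) mod p" by simp
    also have "\<dots> = b - a + p" using False ab by (intro mod_pos_pos_trivial) auto
    finally show ?thesis using False by simp
  qed (use ab in \<open>auto intro: mod_pos_pos_trivial\<close>)
  ultimately show False using ab assms(2) by (auto simp: circ_adj_def split: if_splits)
qed

lemma window_indep:
  assumes "0 < q" "q \<le> p"
  shows "circ_indep p q (window p q i)"
  unfolding circ_indep_def
proof (intro conjI ballI notI)
  show "window p q i \<subseteq> {0..<p}" by (auto simp: window_def)
  fix a b assume ab: "a \<in> window p q i" "b \<in> window p q i" "circ_adj p q a b"
  define x y where "x = (a - i) mod p" and "y = (b - i) mod p"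
  have xy: "0 \<le> x" "x < q" "0 \<le> y" "y < q"
    using ab assms by (auto simp: window_def x_def y_def)
  have "(a - b) mod p = (x - y) mod p"
    by (simp add: x_def y_def mod_diff_eq)
  moreover have "(x - y) mod p = (if y \<le> x then x - y else x - y + p)"
  proof (cases "y \<le> x")
    case False
    have "(x - y) mod p = (x - y + p) mod p" by simp
    also have "\<dots> = x - y + p" using False xy assms by (intro mod_pos_pos_trivial) auto
    finally show ?thesis using False by simp
  qed (use xy assms in \<open>auto intro: mod_pos_pos_trivial\<close>)
  ultimately show False using xy ab(3) by (auto simp: circ_adj_def split: if_splits)
qed

text \<open>Seen from a fixed member of the set, all other members lie at offsets \<open>d\<close> with \<open>d < q\<close> or
  \<open>d > p - q\<close>, and of the two offsets \<open>d\<close> and \<open>d + (p - q)\<close> at most one occurs.\<close>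

lemma card_circ_indep:
  assumes "0 < q" "2 * q \<le> p" "circ_indep p q S"
  shows "card S \<le> nat q"
proof (cases "S = {}")
  case False
  then obtain s where s: "s \<in> S" by blast
  define d where "d j = (j - s) mod p" for j
  define f where "f j = (if d j < q then d j else d j - (p - q))" for j
  have d: "0 \<le> d j" "d j < p" "d j < q \<or> p - q < d j" if "j \<in> S" for j
    using that s assms by (auto simp: d_def circ_indep_def circ_adj_def not_le)
  have diff: "(i - j) mod p = (d i - d j) mod p" for i j
    by (simp add: d_def mod_diff_eq)
  have no: "d i - d j \<noteq> p - q" if "i \<in> S" "j \<in> S" for i j
  proof
    assume "d i - d j = p - q"
    then have "(i - j) mod p = (p - q) mod p" by (metis diff)
    also have "\<dots> = p - q" using assms(1,2) by (intro mod_pos_pos_trivial) auto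
    finally have "(i - j) mod p = p - q" .
    then have "circ_adj p q i j"
      using assms(1,2) by (simp add: circ_adj_def)
    then show False using that assms by (auto simp: circ_indep_def)
  qed
  have inj: "inj_on f S"
  proof (rule inj_onI)
    fix x y assume xy: "x \<in> S" "y \<in> S" "f x = f y"
    have "d x = d y"
      using xy(3) no[OF xy(1,2)] no[OF xy(2,1)] by (simp add: f_def split: if_splits)
    moreover have "x \<in> {0..<p}" "y \<in> {0..<p}"
      using xy(1,2) assms(3) unfolding circ_indep_def by blast+
    ultimately show "x = y"
      using inj_onD[OF inj_on_mod_diff(1)[of s p]] unfolding d_def by blast
  qed
  have "f j \<in> {0..<q}" if "j \<in> S" for j
    using d[OF that] assms(1,2) by (simp add: f_def) linarith
  then have "f ` S \<subseteq> {0..<q}" by blast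
  from card_inj_on_le[OF inj this] show ?thesis by simp
qed simp

definition circ_nbrs :: "int \<Rightarrow> int \<Rightarrow> int set \<Rightarrow> int set" where
  "circ_nbrs p q S = {i\<in>{0..<p}. \<exists>j\<in>S. circ_adj p q i j}"

lemma sum_card_filter_swap:
  assumes "finite A" "finite B"
  shows "(\<Sum>a\<in>A. card {b\<in>B. P a b}) = (\<Sum>b\<in>B. card {a\<in>A. P a b})"
  using sum.swap_restrict[OF assms, of "\<lambda>_ _. 1::nat" P] by simp

text \<open>Replacing the part of a window inside the closed neighbourhood of \<open>S\<close> by \<open>S\<close> keeps it
  independent, so every window meets the closed neighbourhood in at least \<open>card S\<close> points; now
  average over all windows.\<close>

lemma circ_expansion:
  assumes "0 < q" "2 * q \<le> p" "circ_indep p q S"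
  shows "(p - q) * int (card S) \<le> q * int (card (circ_nbrs p q S))"
proof -
  define N where "N = circ_nbrs p q S"
  have S: "S \<subseteq> {0..<p}" and fS: "finite S"
    using assms(3) by (auto simp: circ_indep_def intro: finite_subset)
  have N: "N \<subseteq> {0..<p}"
    by (auto simp: N_def circ_nbrs_def)
  then have fN: "finite N" by (rule finite_subset) simp
  have disj: "S \<inter> N = {}"
    using assms(3) by (auto simp: N_def circ_nbrs_def circ_indep_def)
  have key: "card S \<le> card {l\<in>S \<union> N. l \<in> window p q i}" for i
  proof -
    note fw = finite_window[of p q i]
    have "circ_indep p q (S \<union> (window p q i - (S \<union> N)))"
      unfolding circ_indep_def
    proof (intro conjI ballI)
      have w: "window p q i \<subseteq> {0..<p}" by (auto simp: window_def)
      then show "S \<union> (window p q i - (S \<union> N)) \<subseteq> {0..<p}" using S by blast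
      have SS: "\<not> circ_adj p q a b" if "a \<in> S" "b \<in> S" for a b
        using that assms(3) by (simp add: circ_indep_def)
      have WW: "\<not> circ_adj p q a b" if "a \<in> window p q i" "b \<in> window p q i" for a b
        using that window_indep[of q p i] assms by (simp add: circ_indep_def)
      have WS: "\<not> circ_adj p q a b" if "a \<in> window p q i - N" "b \<in> S" for a b
        using that w by (auto simp: N_def circ_nbrs_def)
      have SW: "\<not> circ_adj p q b a" if "a \<in> window p q i - N" "b \<in> S" for a b
        using WS[OF that] circ_adj_sym[of q p b a] assms by auto
      fix a b assume "a \<in> S \<union> (window p q i - (S \<union> N))" "b \<in> S \<union> (window p q i - (S \<union> N))"
      then show "\<not> circ_adj p q a b" using SS WW WS SW by blast
    qed
    from card_circ_indep[OF assms(1,2) this]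
    have "card S + card (window p q i - (S \<union> N)) \<le> nat q"
      using fS fw by (subst (asm) card_Un_disjoint) auto
    moreover have "card (window p q i) =
        card (window p q i - (S \<union> N)) + card {l\<in>S \<union> N. l \<in> window p q i}"
      by (subst card_Un_disjoint[symmetric]) (use fS fN fw in \<open>auto intro: arg_cong[where f=card]\<close>)
    ultimately show ?thesis using card_window[of q p i] assms by simp
  qed
  have "nat p * card S \<le> (\<Sum>i\<in>{0..<p}. card {l\<in>S \<union> N. l \<in> window p q i})"
    using sum_bounded_below[of "{0..<p}" "card S", OF key] by simp
  also have "\<dots> = (\<Sum>l\<in>S \<union> N. card {i\<in>{0..<p}. l \<in> window p q i})"
    using fS fN by (intro sum_card_filter_swap) auto
  also have "\<dots> = (\<Sum>l\<in>S \<union> N. nat q)"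
    using S N assms by (intro sum.cong refl card_windows_containing) auto
  also have "\<dots> = nat q * (card S + card N)"
    using fS fN disj by (simp add: card_Un_disjoint)
  finally have "int (nat p * card S) \<le> int (nat q * (card S + card N))" by linarith
  then show ?thesis using assms by (simp add: N_def algebra_simps)
qed


section \<open>Unit arcs as color sets\<close>

lemma mem_arc_iff:
  assumes "0 < q"
  shows "x \<in> arc p q i \<longleftrightarrow> \<lfloor>of_int q * x\<rfloor> \<in> window p q i"
proof -
  have "x \<in> {real_of_int l / q..<(l + 1) / q} \<longleftrightarrow> \<lfloor>of_int q * x\<rfloor> = l" for l
    using assms by (auto simp: floor_eq_iff field_simps)
  then show ?thesis by (simp add: arc_def)
qed

lemma frac_color_set_arc:
  assumes "0 < q" "q \<le> p" "p / q \<le> m"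
  shows "frac_color_set m (arc p q i)"
proof -
  let ?I = "\<lambda>l::int. {l / q..<(l + 1) / q}"
  note fin = finite_window[of p q i]
  have "x \<in> {0..<m}" if "x \<in> arc p q i" for x
  proof -
    have "0 \<le> \<lfloor>of_int q * x\<rfloor>" "\<lfloor>of_int q * x\<rfloor> < p"
      using that assms(1) by (auto simp: mem_arc_iff window_def)
    then have "0 \<le> x" "x < p / q"
      using assms(1) by (auto simp: floor_less_iff field_simps zero_le_mult_iff)
    then show ?thesis using assms(3) by simp
  qed
  then have "arc p q i \<subseteq> {0..<m}" by blast
  moreover have "arc p q i \<in> sets lebesgue"
    using fin by (auto simp: arc_def)
  moreover have "emeasure lebesgue (arc p q i) = 1"
  proof -
    have "emeasure lebesgue (arc p q i) = (\<Sum>l\<in>window p q i. emeasure lebesgue (?I l))"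
      unfolding arc_def
    proof (rule sum_emeasure[symmetric])
      have "l = \<lfloor>of_int q * x\<rfloor>" if "x \<in> ?I l" for x l
        using assms that by (auto simp: eq_commute[of l] floor_eq_iff field_simps)
      then show "disjoint_family_on ?I (window p q i)"
        unfolding disjoint_family_on_def by blast
    qed (use fin in auto)
    also have "\<dots> = (\<Sum>l\<in>window p q i. ennreal (1 / q))"
      using assms(1) by (intro sum.cong refl) (simp add: field_simps)
    also have "\<dots> = ennreal (card (window p q i) * (1 / q))"
      using assms(1) by (simp add: ennreal_of_nat_eq_real_of_nat flip: ennreal_mult)
    also have "\<dots> = 1"
      using assms by (simp add: card_window)
    finally show ?thesis .
  qed
  ultimately show ?thesis by (auto simp: frac_color_set_def)
qed

lemma arcs_disjoint:
  assumes "0 < q" "circ_adj p q i j"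
  shows "arc p q i \<inter> arc p q j = {}"
  using windows_disjoint[OF assms] assms(1) by (auto simp: mem_arc_iff)

text \<open>A color in \<open>[0, p / q)\<close> lies in exactly \<open>q\<close> arcs, any other
  color in none.\<close>

lemma card_arcs_containing:
  assumes "0 < q" "q \<le> p"
  shows "card {i\<in>{0..<p}. x \<in> arc p q i} \<le> nat q"
proof (cases "\<lfloor>of_int q * x\<rfloor> \<in> {0..<p}")
  case True
  then show ?thesis using card_windows_containing[OF assms True] assms(1)
    by (simp add: mem_arc_iff)
next
  case False
  then have "{i\<in>{0..<p}. x \<in> arc p q i} = {}"
    using assms by (auto simp: mem_arc_iff window_def)
  then show ?thesis by (simp only: card.empty)
qed

section \<open>Averaging over colors\<close>

text \<open>Both counts are sums of indicators, so integrating the pointwise inequality gives the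
  claim. This carries every passage from counting vertices per color to measures.\<close>

lemma sum_measure_le_of_card_le:
  fixes a b :: real
  assumes fin: "finite I" "finite J"
    and A: "\<And>i. i \<in> I \<Longrightarrow> A i \<in> fmeasurable M" and B: "\<And>j. j \<in> J \<Longrightarrow> B j \<in> fmeasurable M"
    and le: "\<And>x. a * card {i\<in>I. x \<in> A i} \<le> b * card {j\<in>J. x \<in> B j}"
  shows "a * (\<Sum>i\<in>I. measure M (A i)) \<le> b * (\<Sum>j\<in>J. measure M (B j))"
proof -
  have sum_ind: "(\<Sum>i\<in>K. indicator (C i) x) = real (card {i\<in>K. x \<in> C i})"
    if "finite K" for K :: "'k set" and C :: "'k \<Rightarrow> 'c set" and x
    using that by (simp add: indicator_def of_bool_def sum.If_cases Int_def)
  have int: "integrable M (\<lambda>x. \<Sum>i\<in>K. indicator (C i) x :: real)"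
    and val: "(\<integral>x. (\<Sum>i\<in>K. indicator (C i) x) \<partial>M) = (\<Sum>i\<in>K. measure M (C i))"
    if "\<And>i. i \<in> K \<Longrightarrow> C i \<in> fmeasurable M" for K :: "'k set" and C
  proof -
    have i: "integrable M (indicator (C i) :: _ \<Rightarrow> real)" if "i \<in> K" for i
      using \<open>\<And>i. i \<in> K \<Longrightarrow> C i \<in> fmeasurable M\<close>[OF that]
      by (simp add: fmeasurable_def integrable_indicator_iff)
    then show "integrable M (\<lambda>x. \<Sum>i\<in>K. indicator (C i) x :: real)"
      by (rule Bochner_Integration.integrable_sum)
    show "(\<integral>x. (\<Sum>i\<in>K. indicator (C i) x) \<partial>M) = (\<Sum>i\<in>K. measure M (C i))"
      using that i by (subst Bochner_Integration.integral_sum)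
        (auto intro!: sum.cong simp: fmeasurable_def sets.Int_space_eq1 sets.Int_space_eq2)
  qed
  have "(\<integral>x. a * (\<Sum>i\<in>I. indicator (A i) x) \<partial>M) \<le> (\<integral>x. b * (\<Sum>j\<in>J. indicator (B j) x) \<partial>M)"
    by (intro integral_mono integrable_mult_right int A B) (simp_all add: sum_ind fin le)
  then show ?thesis using val[of I A] val[of J B] A B by simp
qed

lemma lmeasurable_Ico: "{a..<b::real} \<in> lmeasurable"
  by (rule bounded_set_imp_lmeasurable) auto

lemma frac_color_setD:
  assumes "frac_color_set m S"
  shows "S \<in> lmeasurable" "measure lebesgue S = 1" "S \<subseteq> {0..<m}"
  using assms by (auto simp: frac_color_set_def fmeasurable_def measure_def)

lemma color_class_indep:
  assumes "frac_coloring {0..<p} (circ_adj p q) m c"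
  shows "circ_indep p q {i\<in>{0..<p}. x \<in> c i}"
  using assms unfolding circ_indep_def frac_coloring_def by blast

lemma sum_measure_coloring:
  assumes "frac_coloring V E m c"
  shows "(\<Sum>v\<in>V. measure lebesgue (c v)) = card V"
proof -
  have "(\<Sum>v\<in>V. measure lebesgue (c v)) = (\<Sum>v\<in>V. 1)"
    using assms by (intro sum.cong refl frac_color_setD(2)[of m]) (simp add: frac_coloring_def)
  then show ?thesis by simp
qed

text \<open>Each color is used on an independent set, hence at most \<open>q\<close> times, so the
  total measure \<open>p\<close> is at most \<open>q * m\<close>.\<close>

lemma circ_coloring_number_ge:
  assumes pq: "0 < q" "2 * q \<le> p" and m: "0 < m"
    and c: "frac_coloring {0..<p} (circ_adj p q) m c"
  shows "p / q \<le> m"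
proof -
  have col: "frac_color_set m (c i)" if "i \<in> {0..<p}" for i
    using c that by (simp add: frac_coloring_def)
  \<comment> \<open>The one-element index set \<open>{0}\<close> turns the right-hand count into the
    indicator of \<open>{0..<m}\<close>.\<close>
  have "1 * (\<Sum>i\<in>{0..<p}. measure lebesgue (c i)) \<le> q * (\<Sum>j\<in>{0::nat}. measure lebesgue {0..<m})"
  proof (rule sum_measure_le_of_card_le)
    fix x
    show "1 * real (card {i\<in>{0..<p}. x \<in> c i}) \<le> q * real (card {j\<in>{0::nat}. x \<in> {0..<m}})"
    proof (cases "x \<in> {0..<m}")
      case True
      from card_circ_indep[OF pq color_class_indep[OF c, of x]] True show ?thesis using pq(1) by simp
    next
      case False
      then have "{i\<in>{0..<p}. x \<in> c i} = {}" using frac_color_setD(3)[OF col] by blast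
      from arg_cong[where f=card, OF this] show ?thesis using pq(1) by simp
    qed
  next
    show "c i \<in> lmeasurable" if "i \<in> {0..<p}" for i
      using that by (rule frac_color_setD(1)[OF col])
  qed (auto intro: lmeasurable_Ico)
  moreover have "(\<Sum>i\<in>{0..<p}. measure lebesgue (c i)) = p"
    using sum_measure_coloring[OF c] pq by simp
  moreover have "measure lebesgue {0..<m} = m" using m by simp
  ultimately have "real_of_int p \<le> q * m" by simp
  then show ?thesis using pq(1) by (simp add: divide_le_eq mult.commute)
qed

text \<open>The vertices that see a color \<open>x\<close> on a neighbour form the neighbourhood of
  the color class of \<open>x\<close>. Integrating \<open>circ_expansion\<close> over
  \<open>x\<close> bounds the average of the measures of \<open>U i\<close> from below, and some
  \<open>i\<close> reaches the average.\<close>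

lemma circ_coloring_large_neighbourhood:
  assumes pq: "0 < q" "2 * q \<le> p"
    and c: "frac_coloring {0..<p} (circ_adj p q) m c"
  obtains i where "i \<in> {0..<p}"
    "p / q - 1 \<le> measure lebesgue (\<Union>j\<in>{j\<in>{0..<p}. circ_adj p q i j}. c j)"
proof -
  define U where "U i = (\<Union>j\<in>{j\<in>{0..<p}. circ_adj p q i j}. c j)" for i
  have col: "frac_color_set m (c i)" if "i \<in> {0..<p}" for i
    using c that by (simp add: frac_coloring_def)
  have "(p - q) * (\<Sum>i\<in>{0..<p}. measure lebesgue (c i)) \<le> q * (\<Sum>i\<in>{0..<p}. measure lebesgue (U i))"
  proof (rule sum_measure_le_of_card_le)
    fix x
    let ?S = "{i\<in>{0..<p}. x \<in> c i}"
    from circ_expansion[OF pq color_class_indep[OF c, of x]]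
    have "real_of_int ((p - q) * int (card ?S)) \<le> real_of_int (q * int (card (circ_nbrs p q ?S)))"
      by (simp only: of_int_le_iff)
    moreover have "circ_nbrs p q ?S = {i\<in>{0..<p}. x \<in> U i}"
      by (auto simp: circ_nbrs_def U_def)
    ultimately show "real_of_int (p - q) * real (card ?S) \<le> q * real (card {i\<in>{0..<p}. x \<in> U i})"
      by simp
  next
    have "finite {j\<in>{0..<p}. circ_adj p q i j}" for i
      by (rule finite_subset[of _ "{0..<p}"]) auto
    then show "U i \<in> lmeasurable" for i
      unfolding U_def by (intro fmeasurable.finite_UN) (use frac_color_setD(1)[OF col] in auto)
  next
    show "c i \<in> lmeasurable" if "i \<in> {0..<p}" for i
      using that by (rule frac_color_setD(1)[OF col])
  qed simp_all
  moreover have "(\<Sum>i\<in>{0..<p}. measure lebesgue (c i)) = p"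
    using sum_measure_coloring[OF c] pq by simp
  ultimately have "(p - q) * p / q \<le> (\<Sum>i\<in>{0..<p}. measure lebesgue (U i))"
    using pq(1) by (simp add: pos_divide_le_eq mult.commute[of _ "real_of_int q"])
  moreover have "(p - q) * p / q = p * (p / q - 1)"
    using pq(1) by (simp add: field_simps)
  ultimately have sum: "p * (p / q - 1) \<le> (\<Sum>i\<in>{0..<p}. measure lebesgue (U i))"
    by simp
  have "\<exists>i\<in>{0..<p}. p / q - 1 \<le> measure lebesgue (U i)"
  proof (rule ccontr)
    assume "\<not> ?thesis"
    then have "(\<Sum>i\<in>{0..<p}. measure lebesgue (U i)) < (\<Sum>i\<in>{0..<p}. p / q - 1)"
      using pq by (intro sum_strict_mono) (auto simp: not_le)
    then show False using sum pq by simp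
  qed
  then show ?thesis using that unfolding U_def by blast
qed

section \<open>The gadget graph and its fractional chromatic number\<close>

fun gadget_rel :: "int \<Rightarrow> int \<Rightarrow> vertex \<Rightarrow> vertex \<Rightarrow> bool" where
  "gadget_rel p q (Core i) (Core j) = circ_adj p q i j"
| "gadget_rel p q (Core i) (Twin j t) = circ_adj p q i j"
| "gadget_rel p q (Twin i t) (Core j) = circ_adj p q i j"
| "gadget_rel p q (Twin i t) (Leaf j s) = (i = j \<and> t = s)"
| "gadget_rel p q (Leaf i t) (Twin j s) = (i = j \<and> t = s)"
| "gadget_rel p q _ _ = False"

definition gadget_leaves :: "int \<Rightarrow> int \<Rightarrow> vertex set" where
  "gadget_leaves p n = case_prod Leaf ` ({0..<p} \<times> {0..<n})"

definition gadget_verts :: "int \<Rightarrow> int \<Rightarrow> vertex set" where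
  "gadget_verts p n =
    Core ` {0..<p} \<union> case_prod Twin ` ({0..<p} \<times> {0..<n}) \<union> gadget_leaves p n"

definition gadget_edge :: "int \<Rightarrow> int \<Rightarrow> int \<Rightarrow> vertex \<Rightarrow> vertex \<Rightarrow> bool" where
  "gadget_edge p q n u v \<longleftrightarrow> u \<in> gadget_verts p n \<and> v \<in> gadget_verts p n \<and> gadget_rel p q u v"

lemma gadget_rel_sym: "0 < q \<Longrightarrow> q \<le> p \<Longrightarrow> gadget_rel p q u v \<Longrightarrow> gadget_rel p q v u"
  by (cases u; cases v) (simp_all add: circ_adj_sym)

lemma gadget_finite_graph:
  assumes "0 < q" "q \<le> p"
  shows "finite_graph (gadget_verts p n) (gadget_edge p q n)"
proof -
  have "\<not> gadget_rel p q v v" for v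
    using assms by (cases v) (auto simp: circ_adj_irrefl)
  moreover have "finite (gadget_verts p n)"
    by (simp add: gadget_verts_def gadget_leaves_def)
  ultimately show ?thesis
    using gadget_rel_sym[OF assms] unfolding finite_graph_def gadget_edge_def by blast
qed

text \<open>The only neighbour of a leaf is its own twin, and twins are pairwise nonadjacent. A
  shortest connection thus reads leaf, twin, core, ..., twin, leaf, with at least four
  edges.\<close>

lemma gadget_leaf_dist:
  assumes "u \<in> gadget_leaves p n" "v \<in> gadget_leaves p n" "u \<noteq> v"
  shows "dist_at_least (gadget_edge p q n) u v 4"
  unfolding dist_at_least_def
proof (intro allI impI)
  fix xs assume xs: "is_walk (gadget_edge p q n) xs \<and> hd xs = u \<and> last xs = v"
  obtain i t j s where uv: "u = Leaf i t" "v = Leaf j s"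
    using assms by (auto simp: gadget_leaves_def)
  have leaf: "x = Twin i t" if "gadget_rel p q (Leaf i t) x \<or> gadget_rel p q x (Leaf i t)" for x i t
    using that by (cases x) auto
  have "is_walk (gadget_edge p q n) ys \<Longrightarrow> is_walk (gadget_rel p q) ys" for ys
    by (induction ys rule: induct_list012) (auto simp: gadget_edge_def)
  then have w: "is_walk (gadget_rel p q) xs" using xs by blast
  show "4 \<le> length xs - 1"
  proof (rule ccontr)
    assume "\<not> 4 \<le> length xs - 1"
    \<comment> \<open>Subtraction on naturals is truncated, so the empty list appears here as well;
      \<open>is_walk\<close> rejects it.\<close>
    then consider "length xs = 0" | "length xs = Suc 0" | "length xs = Suc (Suc 0)"
      | "length xs = Suc (Suc (Suc 0))" | "length xs = Suc (Suc (Suc (Suc 0)))"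
      by linarith
    then show False
      using xs w assms(3) uv
      by cases (auto simp: length_Suc_conv dest!: leaf[OF disjI1] leaf[OF disjI2])
  qed
qed

lemma gadget_coloring:
  assumes "0 < q" "2 * q \<le> p"
  shows "\<exists>c. frac_coloring (gadget_verts p n) (gadget_edge p q n) (p / q) c"
proof -
  \<comment> \<open>\<open>h\<close> is a homomorphism to the circular clique: twins copy their core
    vertex and leaves move to the adjacent residue \<open>i + q\<close>. No reduction mod
    \<open>p\<close> is made, since \<open>circ_adj\<close> and \<open>arc\<close> depend on the
    indices only through residues.\<close>
  define h where "h v = (case v of Core i \<Rightarrow> i | Twin i t \<Rightarrow> i | Leaf i t \<Rightarrow> (i + q))" for v
  have shift: "circ_adj p q i (i + q)" "circ_adj p q (i + q) i" for i
  proof -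
    have "q mod p = q" using assms by (intro mod_pos_pos_trivial) auto
    then show *: "circ_adj p q (i + q) i" using assms by (simp add: circ_adj_def)
    show "circ_adj p q i (i + q)" by (rule circ_adj_sym[OF _ _ *]) (use assms in linarith)+
  qed
  have "circ_adj p q (h u) (h v)" if "gadget_rel p q u v" for u v
    using that shift by (cases u; cases v) (auto simp: h_def)
  then have "frac_coloring (gadget_verts p n) (gadget_edge p q n) (p / q) (\<lambda>v. arc p q (h v))"
    using assms by (simp add: frac_coloring_def gadget_edge_def frac_color_set_arc arcs_disjoint)
  then show ?thesis by blast
qed

lemma gadget_core_coloring:
  assumes "frac_coloring (gadget_verts p n) (gadget_edge p q n) m c"
  shows "frac_coloring {0..<p} (circ_adj p q) m (\<lambda>i. c (Core i))"
proof -
  have "Core i \<in> gadget_verts p n" if "i \<in> {0..<p}" for i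
    using that by (simp add: gadget_verts_def)
  then show ?thesis
    using assms unfolding frac_coloring_def gadget_edge_def by (meson gadget_rel.simps(1))
qed

text \<open>The arc coloring attains the infimum, and the core alone already forces the lower
  bound.\<close>

lemma gadget_frac_chromatic_number:
  assumes "0 < q" "2 * q \<le> p"
  shows "frac_chromatic_number (gadget_verts p n) (gadget_edge p q n) = p / q"
  unfolding frac_chromatic_number_def
proof (rule cInf_eq_minimum)
  show "p / q \<in> {m. 0 < m \<and> (\<exists>c. frac_coloring (gadget_verts p n) (gadget_edge p q n) m c)}"
    using gadget_coloring[OF assms] assms by auto
  show "p / q \<le> m"
    if "m \<in> {m. 0 < m \<and> (\<exists>c. frac_coloring (gadget_verts p n) (gadget_edge p q n) m c)}" for m
    using that gadget_core_coloring circ_coloring_number_ge[OF assms] by blast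
qed

section \<open>The precoloring and the obstruction to extending it\<close>

text \<open>The number \<open>n\<close> of twins per core vertex is also the number of rotations of
  the arc on the circle of length \<open>n / r\<close>, so each core vertex meets every rotation
  once.\<close>

definition gadget_precoloring :: "int \<Rightarrow> int \<Rightarrow> vertex \<Rightarrow> real set" where
  "gadget_precoloring n r v = (case v of Leaf i t \<Rightarrow> arc n r t | _ \<Rightarrow> {})"

lemma gadget_frac_precoloring:
  assumes "0 < r" "r \<le> n" "n / r \<le> m"
  shows "frac_precoloring (gadget_leaves p n) m (gadget_precoloring n r)"
  using frac_color_set_arc[OF assms]
  by (auto simp: frac_precoloring_def gadget_precoloring_def gadget_leaves_def)

text \<open>The \<open>n\<close> overlaps of \<open>U\<close> with the rotated arcs are each at
  least \<open>u + 2 - m\<close> but sum to at most \<open>r * u\<close>. This yields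
  \<open>u * (1 - r / n) \<le> m - 2\<close>, against \<open>gap\<close> because
  \<open>u \<ge> p / q - 1\<close>.\<close>

lemma gadget_not_extends:
  assumes pq: "0 < q" "2 * q \<le> p" and nr: "0 < r" "r \<le> n" "n / r \<le> m"
    and gap: "m - 2 < (p / q - 1) * (1 - r / n)"
  shows "\<not> frac_extends (gadget_verts p n) (gadget_edge p q n) (gadget_leaves p n) m
    (gadget_precoloring n r)"
proof
  assume "frac_extends (gadget_verts p n) (gadget_edge p q n) (gadget_leaves p n) m
    (gadget_precoloring n r)"
  then obtain c where c: "frac_coloring (gadget_verts p n) (gadget_edge p q n) m c"
    and ext: "\<forall>w\<in>gadget_leaves p n. c w = gadget_precoloring n r w"
    by (auto simp: frac_extends_def)
  have col: "frac_color_set m (c v)" if "v \<in> gadget_verts p n" for v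
    using c that by (simp add: frac_coloring_def)
  let ?N = "\<lambda>i. {j\<in>{0..<p}. circ_adj p q i j}"
  obtain i where i: "i \<in> {0..<p}"
    and large: "p / q - 1 \<le> measure lebesgue (\<Union>j\<in>?N i. c (Core j))"
    using circ_coloring_large_neighbourhood[OF pq gadget_core_coloring[OF c]] by blast
  define U where "U = (\<Union>j\<in>?N i. c (Core j))"
  define u where "u = measure lebesgue U"
  have core: "frac_color_set m (c (Core j))" if "j \<in> ?N i" for j
    using that by (intro col) (simp add: gadget_verts_def)
  have "finite (?N i)"
    by (rule finite_subset[of _ "{0..<p}"]) auto
  then have U: "U \<in> lmeasurable"
    unfolding U_def by (intro fmeasurable.finite_UN) (use frac_color_setD(1)[OF core] in auto)
  have arc: "arc n r t \<in> lmeasurable" "measure lebesgue (arc n r t) = 1" "arc n r t \<subseteq> {0..<m}" for t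
    using frac_color_setD[OF frac_color_set_arc[OF nr]] by auto
  \<comment> \<open>The twin needs measure one outside \<open>U \<union> arc n r t\<close>, so
    \<open>1 + (u + 1 - overlap) \<le> m\<close>.\<close>
  have overlap: "u + 2 - m \<le> measure lebesgue (U \<inter> arc n r t)" if t: "t \<in> {0..<n}" for t
  proof -
    let ?T = "c (Twin i t)"
    have Tv: "Twin i t \<in> gadget_verts p n" and Lv: "Leaf i t \<in> gadget_leaves p n"
      using i t by (auto simp: gadget_verts_def gadget_leaves_def)
    have L: "c (Leaf i t) = arc n r t"
      using ext Lv by (simp add: gadget_precoloring_def)
    have T: "?T \<in> lmeasurable" "measure lebesgue ?T = 1" "?T \<subseteq> {0..<m}"
      using frac_color_setD[OF col[OF Tv]] by auto
    have "?T \<inter> arc n r t = {}"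
      using c Tv Lv L unfolding frac_coloring_def gadget_edge_def gadget_verts_def
      by (metis UnCI gadget_rel.simps(4))
    moreover have "?T \<inter> c (Core j) = {}" if "j \<in> ?N i" for j
      using c Tv that unfolding frac_coloring_def gadget_edge_def
      by (auto simp: gadget_verts_def)
    ultimately have disj: "?T \<inter> (U \<union> arc n r t) = {}" by (auto simp: U_def)
    have "U \<subseteq> {0..<m}" unfolding U_def using frac_color_setD(3)[OF core] by blast
    then have "measure lebesgue (?T \<union> (U \<union> arc n r t)) \<le> measure lebesgue {0..<m}"
      using T U arc by (intro measure_mono_fmeasurable lmeasurable_Ico) auto
    moreover have "measure lebesgue (?T \<union> (U \<union> arc n r t)) =
        measure lebesgue ?T + measure lebesgue (U \<union> arc n r t)"
      using T U arc disj by (subst measure_Un3) auto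
    moreover have "measure lebesgue (U \<union> arc n r t) =
        u + 1 - measure lebesgue (U \<inter> arc n r t)"
      using U arc by (subst measure_Un3) (auto simp: u_def)
    \<comment> \<open>Needed for \<open>{0..<m}\<close> to have measure \<open>m\<close>.\<close>
    moreover have "0 \<le> m" using nr by (smt (verit) divide_nonneg_pos of_int_0_less_iff)
    ultimately show ?thesis using T(2) by simp
  qed
  \<comment> \<open>Every color of \<open>U\<close> lies in at most \<open>r\<close> of the
    \<open>n\<close> rotations.\<close>
  have "1 * (\<Sum>t\<in>{0..<n}. measure lebesgue (U \<inter> arc n r t)) \<le> r * (\<Sum>t\<in>{0::nat}. measure lebesgue U)"
  proof (rule sum_measure_le_of_card_le)
    show "1 * real (card {t\<in>{0..<n}. x \<in> U \<inter> arc n r t}) \<le> r * real (card {t\<in>{0::nat}. x \<in> U})" for x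
      using card_arcs_containing[OF nr(1,2), of x] nr(1) by (cases "x \<in> U") auto
  qed (use U arc in auto)
  moreover have "n * (u + 2 - m) \<le> (\<Sum>t\<in>{0..<n}. measure lebesgue (U \<inter> arc n r t))"
    using sum_mono[of "{0..<n}", OF overlap] nr by simp
  ultimately have "n * (u + 2 - m) \<le> r * u" by (simp add: u_def)
  then have "u * (1 - r / n) \<le> m - 2" using nr by (simp add: field_simps)
  moreover have "(p / q - 1) * (1 - r / n) \<le> u * (1 - r / n)"
    using large nr by (intro mult_right_mono) (auto simp: u_def U_def)
  ultimately show False using gap by simp
qed

section \<open>Transfer to natural-number vertices and choice of parameters\<close>

lemma counterexample_to_nat:
  fixes V :: "'a::countable set"
  assumes "finite_graph V E" "frac_chromatic_number V E = k" "W \<subseteq> V"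
    and "\<And>u v. u \<in> W \<Longrightarrow> v \<in> W \<Longrightarrow> u \<noteq> v \<Longrightarrow> dist_at_least E u v d"
    and "frac_precoloring W m p" "\<not> frac_extends V E W m p"
  shows "\<exists>(V :: nat set) E W p.
    finite_graph V E \<and> frac_chromatic_number V E = k \<and> W \<subseteq> V
    \<and> (\<forall>u\<in>W. \<forall>v\<in>W. u \<noteq> v \<longrightarrow> dist_at_least E u v d)
    \<and> frac_precoloring W m p \<and> \<not> frac_extends V E W m p"
proof (intro exI conjI)
  let ?f = "to_nat :: 'a \<Rightarrow> nat" and ?g = "from_nat :: nat \<Rightarrow> 'a"
  \<comment> \<open>\<open>E'\<close> is the image relation, hence false off the image of
    \<open>V\<close>, as \<open>finite_graph\<close> demands.\<close>
  define V' E' where "V' = ?f ` V" and "E' u v = (\<exists>x y. u = ?f x \<and> v = ?f y \<and> E x y)" for u v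
  have E'[simp]: "E' (?f x) (?f y) = E x y" for x y by (auto simp: E'_def)
  have col: "frac_coloring V' E' m c \<longleftrightarrow> frac_coloring V E m (\<lambda>v. c (?f v))" for m c
    by (simp add: frac_coloring_def V'_def)
  have "(\<exists>c. frac_coloring V' E' m c) \<longleftrightarrow> (\<exists>c. frac_coloring V E m c)" for m
  proof
    assume "\<exists>c. frac_coloring V E m c"
    then obtain c where "frac_coloring V E m c" by blast
    then have "frac_coloring V' E' m (\<lambda>n. c (?g n))" by (simp add: col)
    then show "\<exists>c. frac_coloring V' E' m c" by blast
  qed (auto simp: col)
  then show "frac_chromatic_number V' E' = k"
    using assms(2) by (simp add: frac_chromatic_number_def)
  show "finite_graph V' E'"
    using assms(1) unfolding finite_graph_def V'_def E'_def by auto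
  show "?f ` W \<subseteq> V'" using assms(3) by (auto simp: V'_def)
  \<comment> \<open>Walks pull back along \<open>from_nat\<close> with their length unchanged, so
    distance bounds carry over.\<close>
  have walk: "is_walk E (map ?g xs)" if "is_walk E' xs" for xs
    using that by (induction xs rule: induct_list012) (auto simp: E'_def)
  show "\<forall>u\<in>?f ` W. \<forall>v\<in>?f ` W. u \<noteq> v \<longrightarrow> dist_at_least E' u v d"
  proof (intro ballI impI)
    fix u v assume "u \<in> ?f ` W" "v \<in> ?f ` W" "u \<noteq> v"
    then obtain x y where xy: "u = ?f x" "v = ?f y" "x \<in> W" "y \<in> W" "x \<noteq> y" by auto
    show "dist_at_least E' u v d"
      unfolding dist_at_least_def
    proof (intro allI impI)
      fix xs assume xs: "is_walk E' xs \<and> hd xs = u \<and> last xs = v"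
      then have "xs \<noteq> []" by auto
      then have "hd (map ?g xs) = x" "last (map ?g xs) = y"
        using xs xy by (simp_all add: hd_map last_map)
      then show "d \<le> length xs - 1"
        using assms(4)[OF xy(3-5)] walk xs unfolding dist_at_least_def by (metis length_map)
    qed
  qed
  show "frac_precoloring (?f ` W) m (\<lambda>n. p (?g n))"
    using assms(5) by (simp add: frac_precoloring_def)
  show "\<not> frac_extends V' E' (?f ` W) m (\<lambda>n. p (?g n))"
    using assms(6) unfolding frac_extends_def col by auto
qed

theorem mainTheorem9:
  fixes k \<epsilon> :: real
  assumes "k \<in> \<rat>" and "2 \<le> k" and "k < 3" and "\<epsilon> > 0"
    and "\<epsilon> < (1 + \<epsilon>) / (k + \<epsilon>)"
  shows "\<exists>(V :: nat set) E W p.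
           finite_graph V E \<and> frac_chromatic_number V E = k \<and> W \<subseteq> V
           \<and> (\<forall>u\<in>W. \<forall>v\<in>W. u \<noteq> v \<longrightarrow> dist_at_least E u v 4)
           \<and> frac_precoloring W (k + \<epsilon>) p
           \<and> \<not> frac_extends V E W (k + \<epsilon>) p"
proof -
  obtain p q :: int where pq: "0 < q" "k = p / q"
    by (rule Rats_cases'[OF assms(1)])
  have "2 * real_of_int q \<le> p" using assms(2) pq by (simp add: field_simps)
  then have p2q: "2 * q \<le> p" by linarith
  have eps: "\<epsilon> < 1"
    using assms(2,4,5) by (smt (verit) divide_le_eq_1)
  \<comment> \<open>After clearing denominators this is the hypothesis on \<open>\<epsilon>\<close>.
    A rational \<open>m'\<close> in between gives a circle that splits into finitely many cells,
    fits into \<open>[0, k + \<epsilon>)\<close> and still satisfies \<open>gap\<close>.\<close>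
  have "(k - 1) / (1 - \<epsilon>) < k + \<epsilon>"
    using assms(2,4,5) eps by (simp add: field_simps)
  then obtain m' where m': "m' \<in> \<rat>" "(k - 1) / (1 - \<epsilon>) < m'" "m' < k + \<epsilon>"
    using Rats_dense_in_real by blast
  obtain n r :: int where nr: "0 < r" "m' = n / r"
    by (rule Rats_cases'[OF m'(1)])
  \<comment> \<open>This ensures \<open>m' > 1\<close>, so a unit arc fits on the circle.\<close>
  have "1 \<le> (k - 1) / (1 - \<epsilon>)" using assms(2,4) eps by (simp add: field_simps)
  then have "1 < m'" using m'(2) by simp
  then have "real_of_int r < n" using nr by (simp add: field_simps)
  then have rn: "r \<le> n" by linarith
  have "k - 1 < (1 - \<epsilon>) * m'" using m'(2) eps by (simp add: field_simps)
  then have "(k - 1) / m' < 1 - \<epsilon>" using \<open>1 < m'\<close> by (simp add: field_simps)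
  moreover have "real_of_int r / n = 1 / m'" using nr by simp
  \<comment> \<open>Here \<open>(k - 1) * (1 - 1 / m') = (k - 1) - (k - 1) / m'\<close>, which
    exceeds \<open>(k - 1) - (1 - \<epsilon>)\<close>.\<close>
  ultimately have gap: "k + \<epsilon> - 2 < (p / q - 1) * (1 - r / n)"
    using pq(2) \<open>1 < m'\<close> by (simp add: right_diff_distrib)
  show ?thesis
  proof (rule counterexample_to_nat)
    show "finite_graph (gadget_verts p n) (gadget_edge p q n)"
      using pq p2q by (intro gadget_finite_graph) auto
    show "frac_chromatic_number (gadget_verts p n) (gadget_edge p q n) = k"
      using gadget_frac_chromatic_number[OF pq(1) p2q] pq(2) by simp
    show "gadget_leaves p n \<subseteq> gadget_verts p n" by (simp add: gadget_verts_def)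
    show "frac_precoloring (gadget_leaves p n) (k + \<epsilon>) (gadget_precoloring n r)"
      using m' nr rn by (intro gadget_frac_precoloring) auto
    show "\<not> frac_extends (gadget_verts p n) (gadget_edge p q n) (gadget_leaves p n) (k + \<epsilon>)
        (gadget_precoloring n r)"
      using pq(1) p2q nr rn m' gap by (intro gadget_not_extends) auto
  qed (rule gadget_leaf_dist)
qed

end
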